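(* Let $m,n$ be positive integers. Then either $\Phi_m(q)\le\Phi_n(q)$ for all integers $q\ge 2$, or $\Phi_m(q)\ge\Phi_n(q)$ for all integers $q\ge2$.
   Context: For a positive integer $n$, $\Phi_n$ denotes the $n$-th cyclotomic polynomial, $\Phi_n(x)=\prod_{1\le a\le n,\ \gcd(a,n)=1}(x-\zeta_n^a)$, where $\zeta_n$ is a primitive $n$-th root of unity. *)

theory Defs
  imports Complex_Main "HOL-Computational_Algebra.Polynomial"
begin

(* The product is formed over the complex numbers, with cis (2 * pi / n) as the primitive n-th
   root of unity.  As it has integer coefficients, the polynomial itself is taken in Z[x];
   of_int_cyclotomic_poly below shows that the definite description is well-defined for n > 0. *)
definition cyclotomic_poly :: "nat \<Rightarrow> int poly" where
  "cyclotomic_poly n =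
     (THE p. map_poly of_int p =
       (\<Prod>a | 1 \<le> a \<and> a \<le> n \<and> coprime a n. [:- (cis (2 * pi / real n) ^ a), 1:]))"

lemma Ints_coeff_of_dvd_monic:
  fixes f g h :: "complex poly"
  assumes f: "\<And>i. coeff f i \<in> \<int>" and g: "\<And>i. coeff g i \<in> \<int>"
    and monic: "lead_coeff g = 1" and eq: "f = g * h"
  shows "coeff h i \<in> \<int>"
proof (induction "degree h - i" arbitrary: i rule: less_induct)
  case less
  show ?case
  proof (cases "i > degree h")
    case True
    then show ?thesis by (simp add: coeff_eq_0)
  next
    case False
    define d where "d = degree g"
    define T where "T = (\<lambda>k. coeff g k * coeff h (i + d - k))"
    have "coeff f (i + d) = (\<Sum>k\<le>i + d. T k)"
      by (simp add: eq coeff_mult T_def)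
    also have "\<dots> = (\<Sum>k\<le>d. T k)"
      by (rule sum.mono_neutral_right) (auto simp: T_def d_def coeff_eq_0)
    also have "\<dots> = (\<Sum>k<d. T k) + coeff h i"
      using monic by (simp add: T_def d_def flip: lessThan_Suc_atMost)
    finally have "coeff h i = coeff f (i + d) - (\<Sum>k<d. T k)"
      by simp
    moreover have "T k \<in> \<int>" if "k < d" for k
    proof (cases "i + d - k \<le> degree h")
      case True
      then show ?thesis unfolding T_def using that by (intro Ints_mult g less) auto
    qed (auto simp: T_def coeff_eq_0)
    ultimately show ?thesis
      by (auto intro!: Ints_diff f Ints_sum)
  qed
qed

lemma prod_cyclotomic_complex:
  assumes "n > 0"
  shows "(\<Prod>d | d dvd n. \<Prod>a | 1 \<le> a \<and> a \<le> d \<and> coprime a d. [:- (cis (2 * pi / real d) ^ a), 1:])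
         = (monom 1 n - 1 :: complex poly)"
proof -
  define r where "r = (\<lambda>k. cis (2 * pi * real k / real n))"
  have fin: "finite {d. d dvd n}" using assms by simp
  have finA: "finite {a. 1 \<le> a \<and> a \<le> d \<and> coprime a d}" for d :: nat
    by (rule finite_subset[of _ "{..d}"]) auto
  have "(\<Prod>d | d dvd n. \<Prod>a | 1 \<le> a \<and> a \<le> d \<and> coprime a d. [:- (cis (2 * pi / real d) ^ a), 1:])
      = (\<Prod>(d,a)\<in>(SIGMA d:{d. d dvd n}. {a. 1 \<le> a \<and> a \<le> d \<and> coprime a d}).
           [:- (cis (2 * pi / real d) ^ a), 1:])"
    by (rule prod.Sigma) (use fin finA in auto)
  also have "\<dots> = (\<Prod>k\<in>{1..n}. [:- r k, 1:])"
  proof (rule prod.reindex_bij_witness[of _ "\<lambda>k. (n div gcd k n, k div gcd k n)" "\<lambda>(d,a). a * (n div d)"],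
         goal_cases)
    case (1 x)
    then obtain d a where x: "x = (d, a)" "d dvd n" "1 \<le> a" "a \<le> d" "coprime a d" by auto
    then obtain e where e: "n = d * e" by auto
    with assms have "d > 0" "e > 0" by auto
    moreover have "gcd (a * e) (d * e) = e"
      using x(5) by (metis gcd_mult_distrib_nat coprime_imp_gcd_eq_1 mult.commute mult.right_neutral)
    ultimately show ?case using x e by simp
  next
    case (2 x)
    then obtain d a where x: "x = (d, a)" "d dvd n" "1 \<le> a" "a \<le> d" "coprime a d" by auto
    then obtain e where e: "n = d * e" by auto
    with assms have "d > 0" "e > 0" by auto
    with x e show ?case by simp
  next
    case (3 k)
    then show ?case using assms
      by (simp add: dvd_div_eq_0_iff div_div_eq_right)
  next
    case (4 k)
    then have "k > 0" "k \<le> n" by auto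
    then obtain a d where "k = a * gcd k n" "n = d * gcd k n" "coprime a d"
      using gcd_coprime_exists[of k n] by auto
    moreover have "gcd k n > 0" using assms by simp
    ultimately obtain e where e: "k = a * e" "n = d * e" "e > 0" "gcd k n = e" "coprime a d"
      by metis
    with \<open>k > 0\<close> \<open>k \<le> n\<close> have "a \<ge> 1" "a \<le> d" by auto
    then show ?case using e by simp
  next
    case (5 x)
    then obtain d a where x: "x = (d, a)" "d dvd n" "1 \<le> a" "a \<le> d" "coprime a d" by auto
    then obtain e where e: "n = d * e" by auto
    with assms have "d > 0" "e > 0" by auto
    with x e show ?case by (simp add: r_def Complex.DeMoivre field_simps)
  qed
  also have "\<dots> = (\<Prod>k\<in>{..<n}. [:- r k, 1:])"
    by (rule prod.reindex_bij_witness[of _ "\<lambda>k. if k = 0 then n else k" "\<lambda>k. if k = n then 0 else k"])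
       (use assms in \<open>auto simp: r_def\<close>)
  also have "\<dots> = (\<Prod>z | z ^ n = 1. [:- z, 1:])"
    unfolding r_def by (rule prod.reindex_bij_betw[OF bij_betw_roots_unity[OF assms]])
  also have "\<dots> = monom 1 n - 1" (is "?L = _")
  proof (rule poly_eqI_degree_lead_coeff[where n = n and A = "{z. z ^ n = 1}"])
    have "degree ?L = n"
      using assms by (simp add: degree_prod_eq_sum_degree card_roots_unity_eq)
    have monic: "lead_coeff ?L = 1"
      by (subst lead_coeff_prod) simp
    from \<open>degree ?L = n\<close> show "degree ?L \<le> n" by simp
    show "degree (monom 1 n - 1 :: complex poly) \<le> n"
      by (rule degree_diff_le) (simp_all add: degree_monom_le)
    have "coeff ?L n = 1" using monic by (simp only: \<open>degree ?L = n\<close>)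
    then show "coeff ?L n = coeff (monom 1 n - 1) n"
      using assms by simp
    show "n \<le> card {z::complex. z ^ n = 1}" using assms by (simp add: card_roots_unity_eq)
  next
    fix z :: complex assume "z \<in> {z. z ^ n = 1}"
    then show "poly ?L z = poly (monom 1 n - 1) z"
      using assms by (auto simp: poly_prod poly_monom finite_roots_unity intro!: prod_zero)
  qed
  finally show ?thesis .
qed

lemma Ints_coeff_mult:
  fixes p q :: "complex poly"
  assumes "\<And>i. coeff p i \<in> \<int>" "\<And>i. coeff q i \<in> \<int>"
  shows "coeff (p * q) i \<in> \<int>"
  unfolding coeff_mult by (intro Ints_sum Ints_mult assms)

lemma Ints_coeff_prod:
  fixes p :: "'a \<Rightarrow> complex poly"
  assumes "\<And>x i. x \<in> A \<Longrightarrow> coeff (p x) i \<in> \<int>"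
  shows "coeff (\<Prod>x\<in>A. p x) i \<in> \<int>"
  using assms
  by (induction A arbitrary: i rule: infinite_finite_induct)
     (auto intro!: Ints_coeff_mult simp: coeff_1)

lemma Ints_coeff_cyclotomic_complex:
  assumes "n > 0"
  shows "coeff (\<Prod>a | 1 \<le> a \<and> a \<le> n \<and> coprime a n. [:- (cis (2 * pi / real n) ^ a), 1:]) i \<in> \<int>"
  using assms
proof (induction n arbitrary: i rule: less_induct)
  case (less n)
  define C where
    "C = (\<lambda>d. \<Prod>a | 1 \<le> a \<and> a \<le> d \<and> coprime a d. [:- (cis (2 * pi / real d) ^ a), 1:])"
  have fin: "finite {d. d dvd n}" using less.prems by simp
  have eq: "monom 1 n - 1 = (\<Prod>d\<in>{d. d dvd n} - {n}. C d) * C n"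
    using prod_cyclotomic_complex[OF less.prems] prod.remove[OF fin, of n C]
    by (simp add: C_def mult.commute)
  have int: "coeff (C d) j \<in> \<int>" if "d \<in> {d. d dvd n} - {n}" for d j
    using that less.prems unfolding C_def
    by (intro less.IH) (auto dest: dvd_imp_le intro: Nat.gr0I)
  have "coeff (C n) i \<in> \<int>"
  proof (rule Ints_coeff_of_dvd_monic[OF _ _ _ eq])
    show "coeff (monom 1 n - 1 :: complex poly) j \<in> \<int>" for j
      by (auto simp: coeff_1)
    show "coeff (\<Prod>d\<in>{d. d dvd n} - {n}. C d) j \<in> \<int>" for j
      by (intro Ints_coeff_prod int)
    show "lead_coeff (\<Prod>d\<in>{d. d dvd n} - {n}. C d) = 1"
      by (simp add: lead_coeff_prod C_def)
  qed
  then show ?case by (simp add: C_def)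
qed

lemma of_int_cyclotomic_poly:
  assumes "n > 0"
  shows "map_poly of_int (cyclotomic_poly n) =
    (\<Prod>a | 1 \<le> a \<and> a \<le> n \<and> coprime a n. [:- (cis (2 * pi / real n) ^ a), 1:])" (is "_ = ?P")
  unfolding cyclotomic_poly_def
proof (rule theI')
  show "\<exists>!p. map_poly of_int p = ?P"
  proof (rule ex_ex1I)
    have "map_poly of_int (map_poly floor (map_poly Re ?P)) = ?P"
    proof (rule poly_eqI)
      fix i
      obtain k where "coeff ?P i = of_int k"
        using Ints_coeff_cyclotomic_complex[OF assms, of i] by (auto elim: Ints_cases)
      then show "coeff (map_poly of_int (map_poly floor (map_poly Re ?P))) i = coeff ?P i"
        by (simp add: coeff_map_poly)
    qed
    then show "\<exists>p. map_poly of_int p = ?P" by blast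
  next
    fix p q :: "int poly"
    assume "map_poly of_int p = ?P" "map_poly of_int q = ?P"
    then have "coeff (map_poly of_int p :: complex poly) i = coeff (map_poly of_int q) i" for i
      by simp
    then show "p = q" by (intro poly_eqI) (simp add: coeff_map_poly)
  qed
qed

end

(* Moebius inversion turns prod_{d | n} Phi_d(q) = q^n - 1 into
   ln Phi_n(q) = totient(n) ln q - sum_{d | n} mu(n/d) L_d, where L_d = - ln (1 - q^(-d)).
   For q >= 2 one has L_d >= 2 L_{d+1} >= 0, so that a combination of the L_d with coefficients in
   {-1, 0, 1} has the sign of its first nonzero coefficient, whatever q is.

   Write n = r k with r the radical of n.  The sum over d is mu(r) H(r, k) with
   H(r, k) = sum_{j | r} mu(j) L_{kj}, and 0 <= H(r, k) <= L_k.  Moreover H(r, k) >= H(s, l) if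
   k < l, while for k = l the first coefficient in which H(r, k) and H(s, k) differ belongs to the
   least prime dividing exactly one of r and s.  This orders Phi_m and Phi_n if the totients agree.
   If they do not, then q^totient(n) / 2 <= Phi_n(q) <= 2 q^totient(n) suffices, as totients
   exceeding 1 are even; only m <= 2, where Phi_m(q) <= q + 1, needs separate treatment. *)
theory Submission
  imports Defs "HOL-Computational_Algebra.Squarefree" "HOL-Number_Theory.Totient"
begin

section \<open>The Moebius function and Moebius inversion\<close>

definition mu :: "nat \<Rightarrow> int" where
  "mu n = (if squarefree n then (- 1) ^ card (prime_factors n) else 0)"

lemma mu_1 [simp]: "mu (Suc 0) = 1"
  by (simp add: mu_def)

lemma mu_prime: "prime p \<Longrightarrow> mu p = - 1"
  by (simp add: mu_def squarefree_prime prime_factorization_prime)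

lemma abs_mu_le_1: "\<bar>mu n\<bar> \<le> 1"
  by (simp add: mu_def)

lemma mu_mult_coprime:
  assumes "coprime a b"
  shows "mu (a * b) = mu a * mu b"
proof (cases "a = 0 \<or> b = 0")
  case True
  then show ?thesis by (auto simp: mu_def)
next
  case False
  have "prime_factors a \<inter> prime_factors b = {}"
    using assms by (auto simp: in_prime_factors_iff dest: coprime_common_divisor_nat)
  then have "card (prime_factors (a * b)) = card (prime_factors a) + card (prime_factors b)"
    using False by (simp add: prime_factors_product card_Un_disjoint)
  then show ?thesis
    using assms by (auto simp: mu_def squarefree_mult_coprime power_add
        dest: squarefree_multD)
qed

lemma squarefree_mult_imp_coprime:
  assumes "squarefree (a * b :: nat)"
  shows "coprime a b"
proof (rule coprimeI)
  fix c assume "c dvd a" "c dvd b"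
  then have "c ^ 2 dvd a * b" by (simp add: power2_eq_square mult_dvd_mono)
  with assms show "c dvd 1" by (rule squarefreeD)
qed

lemma squarefree_coprime_div:
  assumes "squarefree (r :: nat)" "j dvd r"
  shows "coprime j (r div j)"
proof -
  have "r = j * (r div j)" using assms(2) by simp
  then show ?thesis using assms(1) by (metis squarefree_mult_imp_coprime)
qed

text \<open>Multiplicativity gives \<open>mu r = mu j * mu (r div j)\<close>, and
  \<open>mu j\<close>, being 1 or -1, is its own inverse.\<close>

lemma mu_div:
  assumes "squarefree r" "j dvd r"
  shows "mu (r div j) = mu r * mu j"
proof -
  have "mu r = mu j * mu (r div j)"
    using mu_mult_coprime[OF squarefree_coprime_div[OF assms]] assms(2) by simp
  moreover have "mu j * mu j = 1"
    using squarefree_mono[OF assms(2,1)] by (simp add: mu_def flip: power_add)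
  ultimately show ?thesis by (metis mult.assoc mult.commute mult_1)
qed

text \<open>Only squarefree divisors contribute. For a fixed prime \<open>p\<close> dividing
  \<open>n\<close>, inserting or removing the factor \<open>p\<close> is an involution
  \<open>t\<close> on them that flips the sign of \<open>mu\<close>.\<close>

lemma sum_mu_divisors:
  assumes "n > 1"
  shows "(\<Sum>d | d dvd n. mu d) = 0"
proof -
  obtain p where p: "prime p" "p dvd n"
    using assms prime_factor_nat[of n] by auto
  let ?D = "{d. d dvd n \<and> squarefree d}"
  define t where "t d = (if p dvd d then d div p else p * d)" for d
  have fin: "finite {d. d dvd n}" using assms by simp
  have "(\<Sum>d | d dvd n. mu d) = (\<Sum>d\<in>?D. mu d)"
    using fin by (intro sum.mono_neutral_right) (auto simp: mu_def)
  have t: "t d \<in> ?D \<and> t (t d) = d \<and> mu (t d) = - mu d" if d: "d \<in> ?D" for d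
  proof (cases "p dvd d")
    case True
    then obtain e where e: "d = p * e" by auto
    have "coprime p e" using d e by (auto dest: squarefree_mult_imp_coprime)
    then have "\<not> p dvd e" using p(1) by (metis coprime_absorb_left not_prime_unit)
    moreover have "mu d = mu p * mu e" using \<open>coprime p e\<close> e mu_mult_coprime by simp
    moreover have "squarefree e" "e dvd n"
      using d e squarefree_multD by (auto dest: dvd_mult_right)
    moreover have "t e = d" using \<open>\<not> p dvd e\<close> e by (simp add: t_def)
    moreover have "t d = e" using p(1) e unfolding t_def by (simp add: prime_gt_0_nat)
    ultimately show ?thesis using e mu_prime[OF p(1)] by simp
  next
    case False
    then have cop: "coprime p d" using p(1) by (simp add: prime_imp_coprime)
    then have "p * d dvd n" using p(2) d by (simp add: divides_mult)
    moreover have "squarefree (p * d)"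
      using cop d p(1) by (simp add: squarefree_mult_coprime squarefree_prime)
    moreover have "t d = p * d" using False by (simp add: t_def)
    moreover have "t (p * d) = d" using p(1) by (simp add: t_def prime_gt_0_nat)
    ultimately show ?thesis using mu_mult_coprime[OF cop] mu_prime[OF p(1)] by simp
  qed
  have "(\<Sum>d\<in>?D. mu d) = (\<Sum>d\<in>?D. - mu d)"
    by (rule sum.reindex_bij_witness[of _ t t]) (simp_all only: t minus_minus)
  then have "(\<Sum>d\<in>?D. mu d) = 0"
    by (simp add: sum_negf)
  with \<open>(\<Sum>d | d dvd n. mu d) = (\<Sum>d\<in>?D. mu d)\<close> show ?thesis by simp
qed

text \<open>Inserting the formula for \<open>g\<close> and exchanging the sums leaves, for each
  \<open>e\<close>, the factor \<open>f e\<close> times the sum of \<open>mu\<close> over the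
  divisors of \<open>n div e\<close>, which vanishes unless \<open>e = n\<close>.\<close>

lemma moebius_inversion:
  fixes f g :: "nat \<Rightarrow> real"
  assumes "\<And>n. n > 0 \<Longrightarrow> g n = (\<Sum>d | d dvd n. f d)" and n: "n > 0"
  shows "f n = (\<Sum>d | d dvd n. of_int (mu (n div d)) * g d)"
proof -
  have fin: "finite {d. d dvd n}" using n by simp
  have pos: "d > 0" if "d dvd n" for d using that n by (auto intro: Nat.gr0I)
  have "(\<Sum>d | d dvd n. of_int (mu (n div d)) * g d)
      = (\<Sum>d | d dvd n. \<Sum>e | e dvd d. of_int (mu (n div d)) * f e)"
    by (intro sum.cong) (auto simp: assms(1) pos sum_distrib_left)
  also have "\<dots> = (\<Sum>d | d dvd n. \<Sum>e | e dvd n \<and> e dvd d. of_int (mu (n div d)) * f e)"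
    by (intro sum.cong) (auto intro: dvd_trans)
  also have "\<dots> = (\<Sum>e | e dvd n. \<Sum>d | d dvd n \<and> e dvd d. of_int (mu (n div d)) * f e)"
    using sum.swap_restrict[OF fin fin, of "\<lambda>d e. of_int (mu (n div d)) * f e" "\<lambda>d e. e dvd d"]
    by simp
  also have "\<dots> = (\<Sum>e | e dvd n. if e = n then f n else 0)"
  proof (intro sum.cong refl)
    fix e assume "e \<in> {e. e dvd n}"
    then obtain c where c: "n = e * c" by auto
    with n have "e > 0" "c > 0" by auto
    \<comment> \<open>As \<open>d\<close> runs over the multiples of \<open>e\<close> that divide
      \<open>n = e * c\<close>, the quotient \<open>n div d\<close> runs over the divisors of
      \<open>c\<close>.\<close>
    have "(\<Sum>d | d dvd n \<and> e dvd d. mu (n div d)) = (\<Sum>d | d dvd c. mu d)"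
      by (rule sum.reindex_bij_witness[of _ "\<lambda>d. n div d" "\<lambda>d. n div d"])
         (use c \<open>e > 0\<close> \<open>c > 0\<close> in \<open>auto elim!: dvdE simp: ac_simps\<close>)
    also have "\<dots> = (if e = n then 1 else 0)"
      using sum_mu_divisors[of c] c \<open>e > 0\<close> \<open>c > 0\<close> by (cases "c = 1") auto
    finally show "(\<Sum>d | d dvd n \<and> e dvd d. of_int (mu (n div d)) * f e) = (if e = n then f n else 0)"
      by (simp flip: sum_distrib_right of_int_sum)
  qed
  also have "\<dots> = f n" using fin by simp
  finally show ?thesis by simp
qed

text \<open>\<open>r\<close> is the product of the primes dividing \<open>n\<close>. The last
  property is the form in which the radical gets used: it forces every \<open>d\<close> with
  \<open>n div d\<close> squarefree to be a multiple of \<open>k\<close>.\<close>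

lemma exists_radical:
  assumes "(n :: nat) > 0"
  obtains r k where "n = r * k" "squarefree r" "r > 0" "k > 0"
    "\<And>e. squarefree e \<Longrightarrow> e dvd n \<Longrightarrow> e dvd r"
proof -
  define r where "r = \<Prod>(prime_factors n)"
  have dvd_r: "e dvd r" if "squarefree e" "e dvd n" for e
  proof -
    have "e \<noteq> 0" using that(1) by (metis not_squarefree_0)
    have "e = (\<Prod>p\<in>prime_factors e. p ^ multiplicity p e)"
      using \<open>e \<noteq> 0\<close> by (simp add: prod_prime_factors)
    also have "\<dots> = \<Prod>(prime_factors e)"
      using that(1) \<open>e \<noteq> 0\<close> by (intro prod.cong) (auto simp: squarefree_factorial_semiring')
    also have "\<dots> dvd r"
      unfolding r_def using that(2) assms by (intro prod_dvd_prod_subset dvd_prime_factors) auto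
    finally show ?thesis .
  qed
  have sq: "squarefree r"
    unfolding r_def
    by (rule squarefree_prod_coprime) (auto simp: in_prime_factors_iff primes_coprime squarefree_prime)
  have "r dvd (\<Prod>p\<in>prime_factors n. p ^ multiplicity p n)"
    unfolding r_def using assms
    by (intro prod_dvd_prod) (auto simp: prime_factors_multiplicity intro!: dvd_power)
  then have "r dvd n" using assms by (simp add: prod_prime_factors)
  then obtain k where "n = r * k" by auto
  with assms have "r > 0" "k > 0" by auto
  from that[OF \<open>n = r * k\<close> sq this dvd_r] show ?thesis .
qed

section \<open>Halving sequences and the sign of the first nonzero coefficient\<close>

text \<open>Index 0 is unconstrained, because the intended sequence - ln (1 - q^(-d)) has no
  meaningful value there.\<close>

definition halving :: "(nat \<Rightarrow> real) \<Rightarrow> bool" where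
  "halving L \<longleftrightarrow> (\<forall>i\<ge>1. 0 \<le> L i \<and> 2 * L (Suc i) \<le> L i)"

lemma halving_nonneg: "halving L \<Longrightarrow> i > 0 \<Longrightarrow> L i \<ge> 0"
  by (simp add: halving_def Suc_le_eq)

lemma halving_Suc: "halving L \<Longrightarrow> i > 0 \<Longrightarrow> 2 * L (Suc i) \<le> L i"
  by (simp add: halving_def Suc_le_eq)

lemma halving_antimono:
  assumes "halving L" "0 < i" "i \<le> j"
  shows "L j \<le> L i"
  using assms(3)
proof (induction rule: dec_induct)
  case (step n)
  then show ?case
    using halving_Suc[OF assms(1), of n] halving_nonneg[OF assms(1), of "Suc n"] assms(2) by simp
qed simp

text \<open>The first nonzero \<open>b d - a d\<close> equals 1, later ones are at least -1, and
  halving lets the leading term outweigh all later ones together. Agreement at 0 is demanded since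
  \<open>L 0\<close> is arbitrary.\<close>

lemma sum_le_if_leading_less:
  fixes a b :: "nat \<Rightarrow> int"
  assumes L: "halving L" and zero: "a 0 = b 0" and bound: "\<And>d. \<bar>b d - a d\<bar> \<le> 1"
    and leading: "\<And>t. t > 0 \<Longrightarrow> a t \<noteq> b t \<Longrightarrow> (\<And>i. i < t \<Longrightarrow> a i = b i) \<Longrightarrow> a t < b t"
  shows "(\<Sum>d\<le>N. of_int (a d) * L d) \<le> (\<Sum>d\<le>N. of_int (b d) * L d)"
proof (cases "\<forall>d\<le>N. a d = b d")
  case True
  then show ?thesis by simp
next
  case False
  define c where "c d = b d - a d" for d
  define t where "t = (LEAST d. c d \<noteq> 0)"
  from False obtain d where d: "d \<le> N" "c d \<noteq> 0" by (auto simp: c_def)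
  then have ct: "c t \<noteq> 0" and "t \<le> N"
    unfolding t_def by (metis (mono_tags, lifting) LeastI, metis (mono_tags, lifting) Least_le order_trans)
  have below: "c i = 0" if "i < t" for i
    using not_less_Least[of i "\<lambda>d. c d \<noteq> 0"] that by (auto simp: t_def)
  have "t > 0" using ct zero by (cases t) (auto simp: c_def)
  have "a t < b t"
    using ct below by (intro leading \<open>t > 0\<close>) (auto simp: c_def)
  then have "c t = 1" using bound[of t] by (simp add: c_def)
  \<comment> \<open>The bound \<open>L N\<close> instead of 0 makes the induction work: a next
    coefficient -1 costs \<open>L (Suc n)\<close>, and
    \<open>L n - L (Suc n) \<ge> L (Suc n)\<close>.\<close>
  have "L N \<le> (\<Sum>d\<le>N. of_int (c d) * L d)"
    using \<open>t \<le> N\<close>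
  proof (induction rule: dec_induct)
    case base
    have "(\<Sum>d\<le>t. of_int (c d) * L d) = (\<Sum>d\<in>{t}. of_int (c d) * L d)"
      by (rule sum.mono_neutral_right) (auto simp: below)
    then show ?case using \<open>c t = 1\<close> by simp
  next
    case (step n)
    have "of_int (c (Suc n)) \<ge> (- 1 :: real)" using bound[of "Suc n"] unfolding c_def by linarith
    then have "of_int (c (Suc n)) * L (Suc n) \<ge> - 1 * L (Suc n)"
      using halving_nonneg[OF L] by (intro mult_right_mono) auto
    then show ?case using step halving_Suc[OF L, of n] \<open>t > 0\<close> by simp
  qed
  moreover have "L N \<ge> 0" using halving_nonneg[OF L, of N] \<open>t \<le> N\<close> \<open>t > 0\<close> by simp
  ultimately show ?thesis by (simp add: c_def left_diff_distrib sum_subtractf)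
qed

section \<open>Moebius sums and their coefficients\<close>

text \<open>The quantity called H(r, k) in the overview.\<close>

definition moebius_sum :: "nat \<Rightarrow> nat \<Rightarrow> (nat \<Rightarrow> real) \<Rightarrow> real" where
  "moebius_sum r k L = (\<Sum>j | j dvd r. of_int (mu j) * L (k * j))"

text \<open>The coefficient of \<open>L d\<close> in \<open>moebius_sum r k L\<close>. Indexing by
  \<open>d\<close> instead of \<open>j\<close> allows sums with different \<open>k\<close> to be
  compared term by term.\<close>

definition moebius_coeff :: "nat \<Rightarrow> nat \<Rightarrow> nat \<Rightarrow> int" where
  "moebius_coeff r k d = (if k dvd d \<and> d div k dvd r then mu (d div k) else 0)"

lemma moebius_coeff_mult:
  assumes "k > 0"
  shows "moebius_coeff r k (k * j) = (if j dvd r then mu j else 0)"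
proof -
  have "k * j div k = j" using assms by simp
  then show ?thesis unfolding moebius_coeff_def by (simp only: dvd_triv_left simp_thms)
qed

lemma moebius_coeff_nonzeroE:
  assumes "moebius_coeff r k d \<noteq> 0"
  obtains j where "d = k * j" "j dvd r"
  using assms by (auto simp: moebius_coeff_def split: if_splits)

lemma moebius_coeff_0 [simp]: "r > 0 \<Longrightarrow> moebius_coeff r k 0 = 0"
  by (simp add: moebius_coeff_def)

lemma abs_moebius_coeff_le_1: "\<bar>moebius_coeff r k d\<bar> \<le> 1"
  by (simp add: moebius_coeff_def abs_mu_le_1)

text \<open>\<open>N\<close> is left free so that the sum can be compared with other combinations
  over a common range.\<close>

lemma moebius_sum_eq:
  assumes "r > 0" "k > 0" "N \<ge> r * k"
  shows "moebius_sum r k L = (\<Sum>d\<le>N. of_int (moebius_coeff r k d) * L d)"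
proof -
  have "moebius_sum r k L = (\<Sum>d\<in>(\<lambda>j. k * j) ` {j. j dvd r}. of_int (moebius_coeff r k d) * L d)"
    unfolding moebius_sum_def using assms(2)
    by (subst sum.reindex) (auto simp: inj_on_def moebius_coeff_mult)
  also have "\<dots> = (\<Sum>d\<le>N. of_int (moebius_coeff r k d) * L d)"
  proof (rule sum.mono_neutral_left)
    show "(\<lambda>j. k * j) ` {j. j dvd r} \<subseteq> {..N}"
    proof clarsimp
      fix j assume "j dvd r"
      then have "k * j \<le> k * r" using assms(1) by (intro mult_le_mono2 dvd_imp_le)
      also have "\<dots> \<le> N" using assms(3) by (simp add: mult.commute)
      finally show "k * j \<le> N" .
    qed
  next
    show "\<forall>d\<in>{..N} - (\<lambda>j. k * j) ` {j. j dvd r}. of_int (moebius_coeff r k d) * L d = 0"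
      by (auto elim: moebius_coeff_nonzeroE)
  qed simp
  finally show ?thesis .
qed

lemma sum_single:
  fixes L :: "nat \<Rightarrow> real"
  assumes "a \<le> N"
  shows "(\<Sum>d\<le>N. of_int (if d = a then 1 else 0) * L d) = L a"
proof -
  have "(\<Sum>d\<le>N. of_int (if d = a then 1 else 0) * L d) = (\<Sum>d\<le>N. if d = a then L d else 0)"
    by (intro sum.cong) auto
  then show ?thesis using assms by simp
qed

lemma moebius_coeff_self [simp]: "k > 0 \<Longrightarrow> moebius_coeff r k k = 1"
  using moebius_coeff_mult[of k r 1] by simp

lemma moebius_coeff_nonzero_ge:
  assumes "moebius_coeff r k d \<noteq> 0" "d > 0"
  shows "k \<le> d"
  using assms by (auto elim!: moebius_coeff_nonzeroE)

section \<open>Bounds for a single Moebius sum\<close>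

text \<open>The first nonzero coefficient is the 1 in front of \<open>L k\<close>.\<close>

lemma moebius_sum_nonneg:
  assumes L: "halving L" and "r > 0" "k > 0"
  shows "moebius_sum r k L \<ge> 0"
proof -
  have "(\<Sum>d\<le>r * k. of_int 0 * L d) \<le> (\<Sum>d\<le>r * k. of_int (moebius_coeff r k d) * L d)"
  proof (rule sum_le_if_leading_less[OF L])
    fix t assume t: "t > 0" "0 \<noteq> moebius_coeff r k t" "\<And>i. i < t \<Longrightarrow> 0 = moebius_coeff r k i"
    have "k \<le> t" using t(1,2) moebius_coeff_nonzero_ge[of r k t] by simp
    moreover have "\<not> k < t" using t(3)[of k] assms(3) by auto
    ultimately have "t = k" by simp
    then show "0 < moebius_coeff r k t" using assms(3) by simp
  qed (use assms(2) in \<open>simp_all add: abs_moebius_coeff_le_1\<close>)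
  then show ?thesis using moebius_sum_eq[of r k "r * k" L] assms by simp
qed

text \<open>After \<open>L k\<close>, the next nonzero coefficient, if any, is the -1 at
  \<open>k * p\<close> with \<open>p\<close> the least prime factor of \<open>r\<close>.\<close>

lemma moebius_sum_le_leading:
  assumes L: "halving L" and "squarefree r" "k > 0"
  shows "moebius_sum r k L \<le> L k"
proof -
  have "r > 0" using assms(2) by (intro Nat.gr0I) auto
  define e :: "nat \<Rightarrow> int" where "e d = (if d = k then 1 else 0)" for d
  have ck: "moebius_coeff r k k = e k"
    using assms(3) by (simp add: e_def)
  have "(\<Sum>d\<le>r * k. of_int (moebius_coeff r k d) * L d) \<le> (\<Sum>d\<le>r * k. of_int (e d) * L d)"
  proof (rule sum_le_if_leading_less[OF L])
    show "\<bar>e d - moebius_coeff r k d\<bar> \<le> 1" for d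
      using ck abs_moebius_coeff_le_1[of r k d] by (cases "d = k") (auto simp: e_def)
  next
    fix t assume t: "t > 0" "moebius_coeff r k t \<noteq> e t"
      "\<And>i. i < t \<Longrightarrow> moebius_coeff r k i = e i"
    then have "t \<noteq> k" using ck by auto
    with t obtain j where j: "t = k * j" "j dvd r"
      by (auto simp: e_def elim: moebius_coeff_nonzeroE)
    \<comment> \<open>The coefficients also differ at \<open>k * p\<close> for every prime
      \<open>p\<close> dividing \<open>j\<close>, so minimality of \<open>t = k * j\<close> forces
      \<open>j = p\<close>.\<close>
    with \<open>t \<noteq> k\<close> obtain p where p: "prime p" "p dvd j"
      using prime_factor_nat[of j] by auto
    have cp: "moebius_coeff r k (k * p) = - 1" "e (k * p) = 0"
      using p j assms(3) dvd_trans[of p j r] prime_gt_1_nat[OF p(1)]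
      by (auto simp: e_def moebius_coeff_mult mu_prime)
    with t(3)[of "k * p"] have "p \<ge> j" using j assms(3) by (auto simp: not_less[symmetric])
    moreover have "p \<le> j" using p t(1) j by (intro dvd_imp_le) auto
    ultimately have "p = j" by simp
    with cp j show "moebius_coeff r k t < e t" by simp
  qed (use \<open>r > 0\<close> assms(3) in \<open>simp add: e_def\<close>)
  then show ?thesis
    using \<open>r > 0\<close> assms(3) sum_single[of k "r * k" L]
      moebius_sum_eq[of r k "r * k" L] unfolding e_def by simp
qed

text \<open>The first difference from the single term \<open>L (Suc k)\<close> is the coefficient 1
  at \<open>k\<close>.\<close>

lemma moebius_sum_ge_Suc:
  assumes L: "halving L" and "r > 0" "k \<ge> 2"
  shows "moebius_sum r k L \<ge> L (Suc k)"
proof -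
  define e :: "nat \<Rightarrow> int" where "e d = (if d = Suc k then 1 else 0)" for d
  \<comment> \<open>This is where \<open>k \<ge> 2\<close> matters: for \<open>k = 1\<close> and
    even \<open>r\<close> the coefficients at \<open>Suc k\<close> would be -1 and 1, violating the
    bound on the differences.\<close>
  have "\<not> k dvd Suc k"
    using assms(3) by (metis dvd_add_right_iff dvd_refl Suc_eq_plus1 nat_dvd_1_iff_1 numeral_le_one_iff semiring_norm(69))
  then have cS: "moebius_coeff r k (Suc k) = 0" by (simp add: moebius_coeff_def)
  have "(\<Sum>d\<le>r * k + Suc k. of_int (e d) * L d)
      \<le> (\<Sum>d\<le>r * k + Suc k. of_int (moebius_coeff r k d) * L d)"
  proof (rule sum_le_if_leading_less[OF L])
    show "\<bar>moebius_coeff r k d - e d\<bar> \<le> 1" for d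
      using cS abs_moebius_coeff_le_1[of r k d] by (auto simp: e_def)
  next
    fix t assume t: "t > 0" "e t \<noteq> moebius_coeff r k t"
      "\<And>i. i < t \<Longrightarrow> e i = moebius_coeff r k i"
    have "t \<ge> k"
      using t(1,2) moebius_coeff_nonzero_ge[of r k t] by (auto simp: e_def split: if_splits)
    moreover have "\<not> k < t" using t(3)[of k] assms(3) by (auto simp: e_def)
    ultimately show "e t < moebius_coeff r k t" using assms(3) by (simp add: e_def)
  qed (use assms in \<open>simp add: e_def\<close>)
  then show ?thesis
    using assms sum_single[of "Suc k" "r * k + Suc k" L]
      moebius_sum_eq[of r k "r * k + Suc k" L] unfolding e_def by linarith
qed

lemma mu_4: "mu 4 = 0"
proof -
  have "\<not> squarefree (4 :: nat)" by (rule not_squarefreeI[of 2]) auto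
  then show ?thesis by (simp add: mu_def)
qed

lemma mu_6: "mu 6 = 1"
proof -
  have "coprime 2 (3 :: nat)" by simp
  from mu_mult_coprime[OF this] show ?thesis by (simp add: mu_prime)
qed

text \<open>The right-hand side is the worst case. If 2 or 3 does not divide \<open>r\<close>, the
  corresponding subtraction is absent; if both do, then \<open>L 6\<close> occurs with coefficient 1
  and outweighs everything after it.\<close>

lemma moebius_sum_1_ge:
  assumes L: "halving L" and "r > 0"
  shows "moebius_sum r 1 L \<ge> L 1 - L 2 - L 3 - L 5"
proof -
  define e :: "nat \<Rightarrow> int" where
    "e d = (if d = 1 then 1 else if d \<in> {2, 3, 5} then - 1 else 0)" for d
  define c where "c = moebius_coeff r 1"
  have c: "c d = (if d dvd r then mu d else 0)" for d
    by (simp add: c_def moebius_coeff_def)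
  have c_small: "c 1 = 1" "c 2 = (if 2 dvd r then - 1 else 0)" "c 3 = (if 3 dvd r then - 1 else 0)"
    "c 4 = 0" "c 5 = (if 5 dvd r then - 1 else 0)" "c 6 = (if 6 dvd r then 1 else 0)"
    by (simp_all add: c mu_prime mu_4 mu_6)
  have "(\<Sum>d\<le>r + 5. of_int (e d) * L d) \<le> (\<Sum>d\<le>r + 5. of_int (c d) * L d)"
  proof (rule sum_le_if_leading_less[OF L])
    show "e 0 = c 0" using assms(2) by (simp add: e_def c)
  next
    \<comment> \<open>At 1, 2, 3 and 5 the two coefficients never have opposite nonzero signs;
      elsewhere \<open>e\<close> is 0.\<close>
    show "\<bar>c d - e d\<bar> \<le> 1" for d
    proof (cases "d \<in> {1, 2, 3, 5}")
      case True
      then consider "d = 1" | "d = 2" | "d = 3" | "d = 5" by blast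
      then show ?thesis by cases (simp_all add: e_def c_small del: One_nat_def)
    next
      case False
      then show ?thesis using abs_mu_le_1[of d] by (simp add: c e_def)
    qed
  next
    fix t assume t: "t > 0" "e t \<noteq> c t" "\<And>i. i < t \<Longrightarrow> e i = c i"
    have "t \<noteq> 1" "t \<noteq> 4" using t(2) c_small(1,4) by (auto simp: e_def)
    then have "t = 2 \<or> t = 3 \<or> t = 5 \<or> t \<ge> 6"
      using \<open>t > 0\<close> by arith
    then consider "t = 2" | "t = 3" | "t = 5" | "t \<ge> 6" by blast
    then show "e t < c t"
    proof cases
      case 4
      \<comment> \<open>Agreement at 2 and 3 forces 6 to divide \<open>r\<close>, so the first
        difference is at 6 at the latest.\<close>
      have "2 dvd r" "3 dvd r"
        using t(3)[of 2] t(3)[of 3] 4 c_small(2,3) by (simp_all add: e_def split: if_splits)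
      then have "2 * 3 dvd r" by (intro divides_mult) auto
      then have "c 6 = 1" "e 6 = 0" using c_small(6) by (simp_all add: e_def)
      with t(3)[of 6] 4 have "t = 6" by (cases "t = 6") simp_all
      then show ?thesis using \<open>c 6 = 1\<close> \<open>e 6 = 0\<close> by simp
    qed (use t(2) c_small(2,3,5) in \<open>simp_all add: e_def split: if_splits\<close>)
  qed
  moreover have "(\<Sum>d\<le>r + 5. of_int (e d) * L d) = (\<Sum>d\<in>{1, 2, 3, 5}. of_int (e d) * L d)"
    by (rule sum.mono_neutral_right) (auto simp: e_def)
  moreover have "\<dots> = L 1 - L 2 - L 3 - L 5"
    by (simp add: e_def)
  ultimately show ?thesis using assms(2) moebius_sum_eq[of r 1 "r + 5" L] unfolding c_def by simp
qed

text \<open>For even \<open>r\<close> the coefficients at 2 and 4 agree on both sides. The next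
  nonzero one, if any, is the -1 at \<open>2 * p\<close> with \<open>p\<close> the least odd prime
  factor of \<open>r\<close>.\<close>

lemma moebius_sum_2_le:
  assumes L: "halving L" and "squarefree r" "even r"
  shows "moebius_sum r 2 L \<le> L 2 - L 4"
proof -
  have "r > 0" using assms(2) by (intro Nat.gr0I) auto
  define e :: "nat \<Rightarrow> int" where
    "e d = (if d = 2 then 1 else if d = 4 then - 1 else 0)" for d
  let ?c = "moebius_coeff r 2"
  have c2: "?c 2 = e 2" by (simp add: e_def)
  have c4: "?c 4 = e 4"
    using moebius_coeff_mult[of 2 r 2] assms(3) by (simp add: e_def mu_prime)
  have "(\<Sum>d\<le>r * 2 + 4. of_int (?c d) * L d) \<le> (\<Sum>d\<le>r * 2 + 4. of_int (e d) * L d)"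
  proof (rule sum_le_if_leading_less[OF L])
    show "\<bar>e d - ?c d\<bar> \<le> 1" for d
    proof (cases "d = 2 \<or> d = 4")
      case True
      then show ?thesis using c2 c4 by auto
    next
      case False
      then show ?thesis using abs_moebius_coeff_le_1[of r 2 d] by (simp add: e_def)
    qed
  next
    fix t assume t: "t > 0" "?c t \<noteq> e t" "\<And>i. i < t \<Longrightarrow> ?c i = e i"
    then have t24: "t \<noteq> 2" "t \<noteq> 4" using c2 c4 by auto
    with t obtain j where j: "t = 2 * j" "j dvd r"
      by (auto simp: e_def elim: moebius_coeff_nonzeroE)
    with t24 t(1) have "j > 2" by simp
    have "squarefree j" using j(2) assms(2) by (rule squarefree_mono)
    \<comment> \<open>Being squarefree and larger than 2, \<open>j\<close> is not a power of
      2.\<close>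
    have "\<exists>p. prime p \<and> p dvd j \<and> p \<noteq> 2"
    proof (cases "even j")
      case True
      then obtain i where i: "j = 2 * i" by auto
      with \<open>j > 2\<close> obtain p where p: "prime p" "p dvd i"
        using prime_factor_nat[of i] by auto
      moreover have "coprime 2 i" using \<open>squarefree j\<close> i squarefree_mult_imp_coprime by blast
      ultimately have "p \<noteq> 2" by auto
      with p i show ?thesis by auto
    next
      case False
      then show ?thesis using prime_factor_nat[of j] \<open>j > 2\<close> by auto
    qed
    then obtain p where p: "prime p" "p dvd j" "p \<noteq> 2" by auto
    have cp: "?c (2 * p) = - 1" "e (2 * p) = 0"
      using p j dvd_trans[of p j r] prime_gt_1_nat[OF p(1)]
      by (auto simp: e_def moebius_coeff_mult mu_prime)
    with t(3)[of "2 * p"] have "p \<ge> j" using j by (auto simp: not_less[symmetric])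
    moreover have "p \<le> j" using p \<open>j > 2\<close> by (intro dvd_imp_le) auto
    ultimately have "p = j" by simp
    with cp j show "?c t < e t" by simp
  qed (use \<open>r > 0\<close> in \<open>simp add: e_def\<close>)
  moreover have "(\<Sum>d\<le>r * 2 + 4. of_int (e d) * L d) = (\<Sum>d\<in>{2, 4}. of_int (e d) * L d)"
    by (rule sum.mono_neutral_right) (auto simp: e_def)
  moreover have "\<dots> = L 2 - L 4"
    by (simp add: e_def)
  ultimately show ?thesis using \<open>r > 0\<close> moebius_sum_eq[of r 2 "r * 2 + 4" L] by simp
qed

section \<open>Comparison of two Moebius sums\<close>

text \<open>For \<open>k \<ge> 2\<close> the value \<open>L (Suc k)\<close> separates the two sums.
  For \<open>k = 1\<close> the separation is between \<open>L 2 - L 4\<close> and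
  \<open>L 1 - L 2 - L 3 - L 5\<close>, whose order is exactly \<open>extra\<close>; when
  \<open>l = 2\<close>, \<open>prime_l\<close> makes \<open>s\<close> even, as the upper bound
  needs.\<close>

lemma moebius_sum_antimono:
  assumes L: "halving L" and extra: "2 * L 2 + L 3 + L 5 \<le> L 1 + L 4"
    and "squarefree r" "squarefree s" "0 < k" "k < l"
    and prime_l: "\<And>p. prime p \<Longrightarrow> p dvd l \<Longrightarrow> p dvd s"
  shows "moebius_sum s l L \<le> moebius_sum r k L"
proof -
  have "r > 0" using assms(3) by (intro Nat.gr0I) auto
  show ?thesis
  proof (cases "k = 1")
    case True
    have "moebius_sum s l L \<le> L 2 - L 4"
    proof (cases "l = 2")
      case True
      then show ?thesis using moebius_sum_2_le[OF L assms(4)] prime_l[of 2] by simp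
    next
      case False
      have "moebius_sum s l L \<le> L l"
        using moebius_sum_le_leading[OF L assms(4)] assms(6) by simp
      also have "\<dots> \<le> L 3"
        using False \<open>k = 1\<close> assms(6) by (intro halving_antimono[OF L]) auto
      also have "\<dots> \<le> L 2 - L 4"
        using halving_Suc[OF L, of 2] halving_Suc[OF L, of 3] halving_nonneg[OF L, of 4]
        by (simp add: eval_nat_numeral)
      finally show ?thesis .
    qed
    also have "\<dots> \<le> L 1 - L 2 - L 3 - L 5" using extra by simp
    also have "\<dots> \<le> moebius_sum r k L"
      using moebius_sum_1_ge[OF L \<open>r > 0\<close>] True by simp
    finally show ?thesis .
  next
    case False
    have "moebius_sum s l L \<le> L l"
      using moebius_sum_le_leading[OF L assms(4)] assms(6) by simp
    also have "\<dots> \<le> L (Suc k)"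
      using assms(6) by (intro halving_antimono[OF L]) auto
    also have "\<dots> \<le> moebius_sum r k L"
      using moebius_sum_ge_Suc[OF L \<open>r > 0\<close>] False assms(5) by simp
    finally show ?thesis .
  qed
qed

text \<open>Below \<open>k * p\<close> all coefficients agree, and at \<open>k * p\<close> they are
  -1 and 0.\<close>

lemma moebius_sum_le_if_first_prime:
  assumes L: "halving L" and "r > 0" "s > 0" "k > 0"
    and p: "prime p" "p dvd r" "\<not> p dvd s"
    and below: "\<And>i. i < p \<Longrightarrow> i dvd r \<longleftrightarrow> i dvd s"
  shows "moebius_sum r k L \<le> moebius_sum s k L"
proof -
  let ?N = "r * k + s * k"
  let ?a = "moebius_coeff r k" and ?b = "moebius_coeff s k"
  have kp: "?a (k * p) = - 1" "?b (k * p) = 0"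
    using assms(4) p by (simp_all add: moebius_coeff_mult mu_prime)
  have eq: "?a i = ?b i" if "i < k * p" for i
    using below[of "i div k"] that assms(4)
    by (auto simp: moebius_coeff_def less_mult_imp_div_less mult.commute)
  have "(\<Sum>d\<le>?N. of_int (?a d) * L d) \<le> (\<Sum>d\<le>?N. of_int (?b d) * L d)"
  proof (rule sum_le_if_leading_less[OF L])
    \<comment> \<open>As \<open>k\<close> is the same, both coefficients lie in {0,
      \<open>mu (d div k)\<close>}.\<close>
    show "\<bar>?b d - ?a d\<bar> \<le> 1" for d
      by (auto simp: moebius_coeff_def abs_mu_le_1)
  next
    fix t assume t: "?a t \<noteq> ?b t" "\<And>i. i < t \<Longrightarrow> ?a i = ?b i"
    have "t = k * p"
      using t(1) t(2)[of "k * p"] eq[of t] kp by (cases t "k * p" rule: linorder_cases) auto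
    then show "?a t < ?b t" using kp by simp
  qed (use assms in simp)
  then show ?thesis
    using assms moebius_sum_eq[of r k ?N L] moebius_sum_eq[of s k ?N L] by simp
qed

text \<open>The least number dividing exactly one of \<open>r\<close> and \<open>s\<close> is prime,
  so the previous lemma decides the order independently of \<open>L\<close>.\<close>

lemma moebius_sum_total:
  assumes "r > 0" "s > 0" "squarefree r" "squarefree s" "k > 0"
  shows "(\<forall>L. halving L \<longrightarrow> moebius_sum r k L \<le> moebius_sum s k L) \<or>
         (\<forall>L. halving L \<longrightarrow> moebius_sum s k L \<le> moebius_sum r k L)"
proof (cases "r = s")
  case False
  define p where "p = (LEAST j. j dvd r \<longleftrightarrow> \<not> j dvd s)"
  have "\<exists>j. j dvd r \<longleftrightarrow> \<not> j dvd s" using False by (meson dvd_antisym dvd_refl)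
  then have diff: "p dvd r \<longleftrightarrow> \<not> p dvd s" unfolding p_def by (rule LeastI_ex)
  have below: "i dvd r \<longleftrightarrow> i dvd s" if "i < p" for i
    using not_less_Least that unfolding p_def by blast
  have "p > 0" using diff assms(1,2) by (auto intro: Nat.gr0I)
  have "p \<noteq> 1" using diff by auto
  have "squarefree p"
    using diff assms(3,4) squarefree_mono by blast
  have "prime p"
  proof (rule ccontr)
    assume "\<not> prime p"
    obtain x where x: "prime x" "x dvd p" using prime_factor_nat[OF \<open>p \<noteq> 1\<close>] by auto
    then obtain y where y: "p = x * y" by auto
    have "y \<noteq> 1" using x y \<open>\<not> prime p\<close> by auto
    have "x < p" "y < p"
      using y \<open>p > 0\<close> \<open>y \<noteq> 1\<close> prime_gt_1_nat[OF x(1)] by auto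
    have "coprime x y" using \<open>squarefree p\<close> y squarefree_mult_imp_coprime by blast
    \<comment> \<open>A composite \<open>p\<close> would split into smaller coprime factors, each
      dividing both or neither of \<open>r\<close> and \<open>s\<close>; then the same would hold
      for \<open>p\<close>.\<close>
    then have "p dvd z \<longleftrightarrow> x dvd z \<and> y dvd z" for z
      using y by (auto intro: divides_mult dvd_mult_left dvd_mult_right)
    from this[of r] this[of s] diff below[OF \<open>x < p\<close>] below[OF \<open>y < p\<close>] show False by blast
  qed
  show ?thesis
  proof (cases "p dvd r")
    case True
    then show ?thesis
      using moebius_sum_le_if_first_prime[OF _ assms(1,2,5) \<open>prime p\<close>] diff below by simp
  next
    case False
    then show ?thesis
      using moebius_sum_le_if_first_prime[OF _ assms(2,1,5) \<open>prime p\<close>] diff below by simp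
  qed
qed simp

text \<open>The halving property alone does not give \<open>moebius_sum s 2 L \<le> moebius_sum r 1 L\<close>: if \<open>r\<close> is
  divisible by 30, the terms \<open>L 2\<close>, \<open>L 3\<close> and \<open>L 5\<close> are all subtracted from \<open>L 1\<close>.\<close>
definition steep :: "(nat \<Rightarrow> real) \<Rightarrow> bool" where
  "steep L \<longleftrightarrow> halving L \<and> 2 * L 2 + L 3 + L 5 \<le> L 1 + L 4"

text \<open>Opposite signs are settled by nonnegativity of the sums, equal signs by comparing the
  sums themselves. Both alternatives quantify over \<open>L\<close>, so the order will not depend on
  q.\<close>

lemma signed_moebius_sum_total:
  assumes "squarefree r" "squarefree s" "k > 0" "l > 0"
    and prime_k: "\<And>p. prime p \<Longrightarrow> p dvd k \<Longrightarrow> p dvd r"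
    and prime_l: "\<And>p. prime p \<Longrightarrow> p dvd l \<Longrightarrow> p dvd s"
  shows "(\<forall>L. steep L \<longrightarrow> of_int (mu r) * moebius_sum r k L \<le> of_int (mu s) * moebius_sum s l L) \<or>
         (\<forall>L. steep L \<longrightarrow> of_int (mu s) * moebius_sum s l L \<le> of_int (mu r) * moebius_sum r k L)"
proof -
  have pos: "r > 0" "s > 0" using assms(1,2) by (auto intro: Nat.gr0I)
  have halving: "halving L" if "steep L" for L using that by (simp add: steep_def)
  have nonneg: "moebius_sum r k L \<ge> 0" "moebius_sum s l L \<ge> 0" if "steep L" for L
    using halving[OF that] pos assms(3,4) by (simp_all add: moebius_sum_nonneg)
  have "mu r \<in> {1, - 1}" "mu s \<in> {1, - 1}"
    using assms(1,2) by (auto simp: mu_def minus_one_power_iff)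
  then consider "mu r = 1" "mu s = - 1" | "mu r = - 1" "mu s = 1"
    | "mu r = mu s" "mu s = 1" | "mu r = mu s" "mu s = - 1" by auto
  moreover have "(\<forall>L. steep L \<longrightarrow> moebius_sum r k L \<le> moebius_sum s l L) \<or>
         (\<forall>L. steep L \<longrightarrow> moebius_sum s l L \<le> moebius_sum r k L)"
  proof (cases k l rule: linorder_cases)
    case less
    have "\<forall>L. steep L \<longrightarrow> moebius_sum s l L \<le> moebius_sum r k L"
      using moebius_sum_antimono[OF _ _ assms(1,2,3) less prime_l] by (simp add: steep_def)
    then show ?thesis ..
  next
    case equal
    then show ?thesis
      using moebius_sum_total[OF pos assms(1,2,3)] halving by auto
  next
    case greater
    have "\<forall>L. steep L \<longrightarrow> moebius_sum r k L \<le> moebius_sum s l L"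
      using moebius_sum_antimono[OF _ _ assms(2,1,4) greater prime_k] by (simp add: steep_def)
    then show ?thesis ..
  qed
  ultimately show ?thesis
  proof cases
    case 1
    have "of_int (mu s) * moebius_sum s l L \<le> of_int (mu r) * moebius_sum r k L" if "steep L" for L
      using 1 nonneg[OF that] by simp
    then show ?thesis by blast
  next
    case 2
    have "of_int (mu r) * moebius_sum r k L \<le> of_int (mu s) * moebius_sum s l L" if "steep L" for L
      using 2 nonneg[OF that] by simp
    then show ?thesis by blast
  qed auto
qed

section \<open>Cyclotomic values and their logarithms\<close>

text \<open>Only those \<open>d\<close> contribute for which \<open>n div d\<close> is squarefree
  and hence divides \<open>r\<close>. They are the \<open>k * j\<close> with \<open>j dvd r\<close>,
  and there \<open>mu (n div d) = mu r * mu j\<close>.\<close>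

lemma sum_mu_eq_moebius_sum:
  assumes n: "n = r * k" and "squarefree r" "k > 0"
    and rad: "\<And>e. squarefree e \<Longrightarrow> e dvd n \<Longrightarrow> e dvd r"
  shows "(\<Sum>d | d dvd n. of_int (mu (n div d)) * L d) = of_int (mu r) * moebius_sum r k L"
proof -
  have "r > 0" using assms(2) by (intro Nat.gr0I) auto
  have div: "n div (k * j) = r div j" for j
    using n assms(3) by (simp add: mult.commute)
  have "of_int (mu r) * moebius_sum r k L = (\<Sum>j | j dvd r. of_int (mu (r div j)) * L (k * j))"
    unfolding moebius_sum_def sum_distrib_left
    by (intro sum.cong) (auto simp: mu_div[OF assms(2)])
  also have "\<dots> = (\<Sum>d\<in>(\<lambda>j. k * j) ` {j. j dvd r}. of_int (mu (n div d)) * L d)"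
    using assms(3) by (subst sum.reindex) (auto simp: inj_on_def div)
  also have "\<dots> = (\<Sum>d | d dvd n. of_int (mu (n div d)) * L d)"
  proof (rule sum.mono_neutral_left)
    show "finite {d. d dvd n}" using n \<open>r > 0\<close> assms(3) by simp
    show "(\<lambda>j. k * j) ` {j. j dvd r} \<subseteq> {d. d dvd n}"
      using n by (auto simp: mult.commute)
    show "\<forall>d\<in>{d. d dvd n} - (\<lambda>j. k * j) ` {j. j dvd r}. of_int (mu (n div d)) * L d = 0"
    proof
      fix d assume d: "d \<in> {d. d dvd n} - (\<lambda>j. k * j) ` {j. j dvd r}"
      then obtain e where e: "n = d * e" by auto
      with n \<open>r > 0\<close> assms(3) have "d > 0" "e > 0" by (auto intro: Nat.gr0I)
      have "\<not> squarefree e"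
      proof
        assume "squarefree e"
        then have "e dvd r" by (rule rad) (simp add: e)
        then obtain j where j: "r = e * j" ..
        with e n \<open>e > 0\<close> have "d = k * j" by (simp add: ac_simps)
        with d j show False by auto
      qed
      then show "of_int (mu (n div d)) * L d = 0"
        using e \<open>d > 0\<close> by (simp add: mu_def)
    qed
  qed
  finally show ?thesis by simp
qed

lemma poly_map_poly_of_int: "poly (map_poly of_int p) (of_int x) = (of_int (poly p x) :: complex)"
  by (induction p) (simp_all add: map_poly_pCons)

lemma prod_poly_cyclotomic_poly:
  assumes "n > 0"
  shows "(\<Prod>d | d dvd n. poly (cyclotomic_poly d) q) = q ^ n - 1"
proof -
  have "complex_of_int (\<Prod>d | d dvd n. poly (cyclotomic_poly d) q)
      = poly (\<Prod>d | d dvd n. map_poly of_int (cyclotomic_poly d)) (of_int q)"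
    by (simp add: poly_prod poly_map_poly_of_int)
  also have "(\<Prod>d | d dvd n. map_poly of_int (cyclotomic_poly d)) = (monom 1 n - 1 :: complex poly)"
    unfolding prod_cyclotomic_complex[OF assms, symmetric]
    using assms by (intro prod.cong of_int_cyclotomic_poly) (auto intro: Nat.gr0I)
  also have "poly \<dots> (of_int q) = of_int (q ^ n - 1)"
    by (simp add: poly_monom)
  finally show ?thesis by (simp only: of_int_eq_iff)
qed

text \<open>Serves to show that the value at 2 is odd.\<close>

lemma poly_cyclotomic_poly_dvd:
  assumes "n > 0"
  shows "poly (cyclotomic_poly n) q dvd q ^ n - 1"
proof -
  have "poly (cyclotomic_poly n) q dvd (\<Prod>d | d dvd n. poly (cyclotomic_poly d) q)"
    using assms by (intro dvd_prodI) auto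
  then show ?thesis by (simp add: prod_poly_cyclotomic_poly[OF assms])
qed

text \<open>By induction the factors of \<open>q ^ n - 1\<close> for proper divisors are positive,
  and so is the product.\<close>

lemma poly_cyclotomic_poly_pos:
  assumes "n > 0" "q \<ge> 2"
  shows "poly (cyclotomic_poly n) q > 0"
  using assms(1)
proof (induction n rule: less_induct)
  case (less n)
  have fin: "finite {d. d dvd n}" using less.prems by simp
  have "poly (cyclotomic_poly d) q > 0" if "d \<in> {d. d dvd n} - {n}" for d
    using that less.prems by (intro less.IH) (auto dest: dvd_imp_le intro: Nat.gr0I)
  then have "(\<Prod>d\<in>{d. d dvd n} - {n}. poly (cyclotomic_poly d) q) > 0"
    by (rule prod_pos)
  moreover have "poly (cyclotomic_poly n) q * (\<Prod>d\<in>{d. d dvd n} - {n}. poly (cyclotomic_poly d) q) = q ^ n - 1"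
    using prod.remove[OF fin, of n "\<lambda>d. poly (cyclotomic_poly d) q"]
    by (simp add: prod_poly_cyclotomic_poly[OF less.prems])
  moreover have "q ^ n > 1"
    using assms(2) less.prems by (intro one_less_power) auto
  ultimately show ?case by (metis diff_gt_0_iff_gt zero_less_mult_pos2)
qed

text \<open>Chosen such that ln (q^d - 1) = d ln q - \<open>log_defect q d\<close> for
  \<open>d > 0\<close>.\<close>

definition log_defect :: "int \<Rightarrow> nat \<Rightarrow> real" where
  "log_defect q d = - ln (1 - (1 / of_int q) ^ d)"

lemma ln_poly_cyclotomic_poly:
  assumes "q \<ge> 2" "n > 0"
  shows "ln (of_int (poly (cyclotomic_poly n) q))
    = real (totient n) * ln (of_int q) - (\<Sum>d | d dvd n. of_int (mu (n div d)) * log_defect q d)"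
proof -
  \<comment> \<open>The divisor sum of \<open>f\<close> is \<open>log_defect q n\<close>, because
    the totients of the divisors of \<open>n\<close> add up to \<open>n\<close>.\<close>
  define f where "f n = real (totient n) * ln (of_int q) - ln (of_int (poly (cyclotomic_poly n) q))" for n
  have "log_defect q n = (\<Sum>d | d dvd n. f d)" if n: "n > 0" for n
  proof -
    have fin: "finite {d. d dvd n}" using n by simp
    have "(\<Sum>d | d dvd n. f d) = (\<Sum>d | d dvd n. real (totient d)) * ln (of_int q)
        - (\<Sum>d | d dvd n. ln (of_int (poly (cyclotomic_poly d) q)))"
      by (simp add: f_def sum_subtractf sum_distrib_right)
    also have "(\<Sum>d | d dvd n. real (totient d)) = real n"
      by (metis totient_divisor_sum of_nat_sum)
    also have "(\<Sum>d | d dvd n. ln (of_int (poly (cyclotomic_poly d) q)))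
        = ln (\<Prod>d | d dvd n. real_of_int (poly (cyclotomic_poly d) q))"
    proof (intro ln_prod[symmetric])
      fix d assume "d \<in> {d. d dvd n}"
      with n have "d > 0" by (auto intro: Nat.gr0I)
      with assms(1) have "poly (cyclotomic_poly d) q > 0" by (intro poly_cyclotomic_poly_pos)
      then show "real_of_int (poly (cyclotomic_poly d) q) \<noteq> 0" by simp
    qed (fact fin)
    also have "\<dots> = ln (of_int q ^ n - 1)"
      using prod_poly_cyclotomic_poly[OF n, of q] by (simp flip: of_int_prod)
    also have "real n * ln (of_int q) - \<dots> = log_defect q n"
    proof -
      have "of_int q ^ n > (1 :: real)"
        using assms(1) n by (intro one_less_power) auto
      moreover have "1 - (1 / of_int q) ^ n = (of_int q ^ n - 1) / (of_int q ^ n :: real)"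
        using assms(1) by (simp add: field_simps)
      ultimately show ?thesis
        using assms(1) by (simp add: log_defect_def ln_div ln_realpow)
    qed
    finally show ?thesis ..
  qed
  from moebius_inversion[of "log_defect q" f, OF this assms(2)] show ?thesis
    by (simp add: f_def)
qed

text \<open>After exponentiation both conditions are polynomial inequalities in
  \<open>x = 1 / q \<le> 1 / 2\<close>.\<close>

lemma steep_log_defect:
  assumes "q \<ge> 2"
  shows "steep (log_defect q)"
proof -
  define x :: real where "x = 1 / of_int q"
  have x: "0 < x" "x \<le> 1 / 2" using assms by (auto simp: x_def field_simps)
  have L: "log_defect q d = - ln (1 - x ^ d)" for d by (simp add: log_defect_def x_def)
  have half: "x ^ Suc i \<le> x ^ i / 2" for i
    using x mult_right_mono[of x "1 / 2" "x ^ i"] by simp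
  have le: "x ^ i \<le> 1 / 2" if "i \<ge> 1" for i
    using power_decreasing[OF that, of x] x by simp
  have "halving (log_defect q)"
    unfolding halving_def
  proof (intro allI impI conjI)
    fix i :: nat assume i: "i \<ge> 1"
    show "0 \<le> log_defect q i" using le[OF i] x by (simp add: L ln_le_zero_iff)
    have "1 - x ^ i \<le> 1 - 2 * x ^ Suc i" using half[of i] by simp
    also have "\<dots> \<le> (1 - x ^ Suc i) ^ 2" by (simp add: power2_diff)
    finally have "ln (1 - x ^ i) \<le> ln ((1 - x ^ Suc i) ^ 2)"
      using le[OF i] by (intro ln_mono) auto
    then show "2 * log_defect q (Suc i) \<le> log_defect q i"
      using le[of "Suc i"] by (simp add: L ln_realpow)
  qed
  moreover have "2 * log_defect q 2 + log_defect q 3 + log_defect q 5 \<le> log_defect q 1 + log_defect q 4"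
  proof -
    have pos: "1 - x ^ i > 0" if "i \<ge> 1" for i using le[OF that] by simp
    \<comment> \<open>Cancelling \<open>(1 - x) * (1 - x ^ 2)\<close> from the exponentiated
      inequality leaves \<open>1 + x ^ 2 \<le> (1 + x) * (1 - x ^ 3) * (1 - x ^ 5)\<close>.
      Expanded, this follows from the bound here, a truncated geometric series.\<close>
    have "x ^ 2 + x ^ 3 + x ^ 4 + x ^ 5 + x ^ 6 \<le> x"
    proof -
      have "x ^ 2 \<le> x / 2" "x ^ 3 \<le> x ^ 2 / 2" "x ^ 4 \<le> x ^ 3 / 2" "x ^ 5 \<le> x ^ 4 / 2"
        "x ^ 6 \<le> x ^ 5 / 2"
        using half[of 1] half[of 2] half[of 3] half[of 4] half[of 5]
        by (simp_all only: Suc_1 Suc_numeral add_num_simps power_one_right)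
      then show ?thesis using x by linarith
    qed
    moreover have "x ^ 8 + x ^ 9 \<ge> 0" using x by simp
    ultimately have "1 + x ^ 2 \<le> (1 + x) * (1 - x ^ 3) * (1 - x ^ 5)"
      by (simp add: algebra_simps flip: power_Suc power_add)
    then have "(1 - x) * (1 - x ^ 2) * (1 + x ^ 2)
        \<le> (1 - x) * (1 - x ^ 2) * ((1 + x) * (1 - x ^ 3) * (1 - x ^ 5))"
      using pos[of 2] x by (intro mult_left_mono) auto
    then have "(1 - x ^ 1) * (1 - x ^ 4) \<le> (1 - x ^ 2) ^ 2 * (1 - x ^ 3) * (1 - x ^ 5)"
      by (simp add: algebra_simps eval_nat_numeral)
    then have "ln ((1 - x ^ 1) * (1 - x ^ 4)) \<le> ln ((1 - x ^ 2) ^ 2 * (1 - x ^ 3) * (1 - x ^ 5))"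
      using pos[of 1] pos[of 4] by (intro ln_mono mult_pos_pos) auto
    also have "\<dots> = 2 * ln (1 - x ^ 2) + ln (1 - x ^ 3) + ln (1 - x ^ 5)"
      using pos[of 2] pos[of 3] pos[of 5] by (simp add: ln_mult ln_realpow)
    also have "ln ((1 - x ^ 1) * (1 - x ^ 4)) = ln (1 - x ^ 1) + ln (1 - x ^ 4)"
      using pos[of 1] pos[of 4] by (intro ln_mult_pos) auto
    finally show ?thesis unfolding L by simp
  qed
  ultimately show ?thesis by (simp add: steep_def)
qed

text \<open>The error is at most \<open>moebius_sum r k\<close>, which is bounded by L_k, hence by
  L_1 = - ln (1 - 1/q), and thus by ln 2.\<close>

lemma abs_ln_poly_cyclotomic_poly_diff_le:
  assumes "q \<ge> 2" "n > 0"
  shows "\<bar>ln (of_int (poly (cyclotomic_poly n) q)) - real (totient n) * ln (of_int q)\<bar> \<le> ln 2"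
proof -
  obtain r k where rk: "n = r * k" "squarefree r" "r > 0" "k > 0"
    and rad: "\<And>e. squarefree e \<Longrightarrow> e dvd n \<Longrightarrow> e dvd r"
    using exists_radical[OF assms(2)] by metis
  have L: "halving (log_defect q)" using steep_log_defect[OF assms(1)] by (simp add: steep_def)
  have "\<bar>of_int (mu r) * moebius_sum r k (log_defect q)\<bar> \<le> 1 * moebius_sum r k (log_defect q)"
    unfolding abs_mult using moebius_sum_nonneg[OF L rk(3,4)] abs_mu_le_1[of r]
    by (intro mult_mono) auto
  also have "\<dots> \<le> log_defect q k"
    using moebius_sum_le_leading[OF L rk(2,4)] by simp
  also have "\<dots> \<le> log_defect q 1"
    using rk(4) by (intro halving_antimono[OF L]) auto
  also have "\<dots> \<le> ln 2"
  proof -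
    have "ln (1 / 2) \<le> ln (1 - 1 / real_of_int q)"
      using assms(1) by (intro ln_mono) (auto simp: field_simps)
    then show ?thesis by (simp add: log_defect_def ln_div)
  qed
  finally show ?thesis
    using ln_poly_cyclotomic_poly[OF assms] sum_mu_eq_moebius_sum[OF rk(1,2,4) rad] by simp
qed

section \<open>Ordering cyclotomic values, first for distinct and then for equal totients\<close>

text \<open>For \<open>m > 2\<close> the even totients differ by at least 2, and the resulting
  factor q^2 \<ge> 4 absorbs both errors of a factor 2. For \<open>m \<le> 2\<close> the bound q^2 /
  2 for the larger value is compared with q + 1.\<close>

lemma poly_cyclotomic_poly_le_if_totient_less:
  assumes q: "q \<ge> 2" and "m > 0" "n > 0" and less: "totient m < totient n"
  shows "poly (cyclotomic_poly m) q \<le> poly (cyclotomic_poly n) q"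
proof -
  let ?P = "\<lambda>n. real_of_int (poly (cyclotomic_poly n) q)"
  have pos: "?P m > 0" "?P n > 0"
    using poly_cyclotomic_poly_pos[OF _ q] assms(2,3) by simp_all
  have "totient m > 0" using assms(2) by simp
  have "n > 2"
  proof (rule ccontr)
    assume "\<not> n > 2"
    then have "n = 1 \<or> n = 2" using assms(3) by arith
    then show False using less \<open>totient m > 0\<close> by auto
  qed
  then have even_n: "even (totient n)" by (rule totient_even)
  have ln_q: "ln (of_int q) \<ge> ln (2 :: real)" using q by (intro ln_mono) auto
  have lower: "ln (?P n) \<ge> real (totient n) * ln (of_int q) - ln 2"
    using abs_ln_poly_cyclotomic_poly_diff_le[OF q assms(3)] by linarith
  show ?thesis
  proof (cases "m > 2")
    case True
    then have "even (totient m)" by (rule totient_even)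
    with even_n less have "totient m + 2 \<le> totient n" by presburger
    then have "real (totient m + 2) * ln (of_int q) \<le> real (totient n) * ln (of_int q)"
      using ln_q ln_2_less_1 by (intro mult_right_mono) (auto intro: order_trans[OF _ ln_q])
    moreover have "ln (?P m) \<le> real (totient m) * ln (of_int q) + ln 2"
      using abs_ln_poly_cyclotomic_poly_diff_le[OF q assms(2)] by linarith
    ultimately have "ln (?P m) \<le> ln (?P n)"
      using lower ln_q by (simp add: distrib_right)
    then show ?thesis using pos by simp
  next
    case False
    then have "m = 1 \<or> m = 2" using assms(2) by arith
    have "{d :: nat. d dvd 2} = {1, 2}"
      using prime_nat_iff[of 2] two_is_prime_nat by auto
    then have "poly (cyclotomic_poly 1) q * poly (cyclotomic_poly 2) q = (q - 1) * (q + 1)"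
      using prod_poly_cyclotomic_poly[of 2 q] by (simp add: algebra_simps power2_eq_square)
    moreover have "poly (cyclotomic_poly 1) q = q - 1"
      using prod_poly_cyclotomic_poly[of 1 q] by simp
    ultimately have m_le: "poly (cyclotomic_poly m) q \<le> q + 1"
      using \<open>m = 1 \<or> m = 2\<close> q by auto
    have "totient n \<ge> 2" using even_n less \<open>totient m > 0\<close> by presburger
    then have "2 * ln (of_int q) \<le> real (totient n) * ln (of_int q)"
      using ln_q by (intro mult_right_mono) (auto intro: order_trans[OF _ ln_q])
    moreover have "ln (of_int q ^ 2 / 2) = 2 * ln (of_int q) - ln (2 :: real)"
      using q by (simp add: ln_div ln_realpow)
    ultimately have "ln (of_int q ^ 2 / 2) \<le> ln (?P n)"
      using lower by linarith
    then have "of_int q ^ 2 / 2 \<le> ?P n"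
      using pos q by simp
    then have "real_of_int (q ^ 2) \<le> real_of_int (2 * poly (cyclotomic_poly n) q)" by simp
    then have n_ge: "q ^ 2 \<le> 2 * poly (cyclotomic_poly n) q" by (simp only: of_int_le_iff)
    show ?thesis
    proof (cases "q = 2")
      case True
      \<comment> \<open>At \<open>q = 2\<close> the bound q^2 / 2 gives only 2, one short of q + 1;
        parity supplies the missing 1.\<close>
      have "odd (q ^ n - 1)" using True assms(3) by simp
      then have "odd (poly (cyclotomic_poly n) q)"
        using poly_cyclotomic_poly_dvd[OF assms(3), of q] dvd_trans by blast
      with n_ge True have "poly (cyclotomic_poly n) q \<ge> 3" by (simp, presburger)
      then show ?thesis using m_le True by simp
    next
      case False
      \<comment> \<open>Now twice the value is at least 3 q, which is at least 2 (q + 1).\<close>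
      with q have "3 * q \<le> q ^ 2" by (simp add: power2_eq_square)
      with n_ge m_le False q show ?thesis by linarith
    qed
  qed
qed

theorem mainTheorem2:
  fixes m n :: nat
  assumes "m > 0" and "n > 0"
  shows "(\<forall>q::int. q \<ge> 2 \<longrightarrow> poly (cyclotomic_poly m) q \<le> poly (cyclotomic_poly n) q) \<or>
         (\<forall>q::int. q \<ge> 2 \<longrightarrow> poly (cyclotomic_poly m) q \<ge> poly (cyclotomic_poly n) q)"
proof (cases "totient m" "totient n" rule: linorder_cases)
  case less
  then show ?thesis using poly_cyclotomic_poly_le_if_totient_less assms by blast
next
  case greater
  then show ?thesis using poly_cyclotomic_poly_le_if_totient_less assms by blast
next
  case equal
  obtain r k where rk: "m = r * k" "squarefree r" "r > 0" "k > 0"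
    and rad_r: "\<And>e. squarefree e \<Longrightarrow> e dvd m \<Longrightarrow> e dvd r"
    using exists_radical[OF assms(1)] by metis
  obtain s l where sl: "n = s * l" "squarefree s" "s > 0" "l > 0"
    and rad_s: "\<And>e. squarefree e \<Longrightarrow> e dvd n \<Longrightarrow> e dvd s"
    using exists_radical[OF assms(2)] by metis
  have cyclotomic_le:
    "poly (cyclotomic_poly a) q \<le> poly (cyclotomic_poly b) q
      \<longleftrightarrow> ln (of_int (poly (cyclotomic_poly a) q)) \<le> ln (real_of_int (poly (cyclotomic_poly b) q))"
    if "q \<ge> 2" "a > 0" "b > 0" for a b q
    using poly_cyclotomic_poly_pos[OF _ that(1)] that(2,3) by simp
  have ln_m: "ln (of_int (poly (cyclotomic_poly m) q))
      = real (totient n) * ln (of_int q) - of_int (mu r) * moebius_sum r k (log_defect q)" if "q \<ge> 2" for q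
    using ln_poly_cyclotomic_poly[OF that assms(1)] sum_mu_eq_moebius_sum[OF rk(1,2,4) rad_r] equal by simp
  have ln_n: "ln (of_int (poly (cyclotomic_poly n) q))
      = real (totient n) * ln (of_int q) - of_int (mu s) * moebius_sum s l (log_defect q)" if "q \<ge> 2" for q
    using ln_poly_cyclotomic_poly[OF that assms(2)] sum_mu_eq_moebius_sum[OF sl(1,2,4) rad_s] by simp
  \<comment> \<open>A prime is squarefree, so every prime factor of \<open>m\<close> divides its
    radical \<open>r\<close>.\<close>
  have "p dvd r" if "prime p" "p dvd k" for p
    using rad_r[OF squarefree_prime[OF that(1)]] that(2) rk(1) by simp
  moreover have "p dvd s" if "prime p" "p dvd l" for p
    using rad_s[OF squarefree_prime[OF that(1)]] that(2) sl(1) by simp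
  ultimately consider
      "\<forall>L. steep L \<longrightarrow> of_int (mu r) * moebius_sum r k L \<le> of_int (mu s) * moebius_sum s l L"
    | "\<forall>L. steep L \<longrightarrow> of_int (mu s) * moebius_sum s l L \<le> of_int (mu r) * moebius_sum r k L"
    using signed_moebius_sum_total[OF rk(2) sl(2) rk(4) sl(4)] by blast
  then show ?thesis
  proof cases
    case 1
    \<comment> \<open>The Moebius sums enter the logarithms with a minus sign, which reverses the
      order.\<close>
    then have "\<forall>q\<ge>2. poly (cyclotomic_poly n) q \<le> poly (cyclotomic_poly m) q"
      using steep_log_defect by (auto simp: cyclotomic_le assms ln_m ln_n)
    then show ?thesis by blast
  next
    case 2
    then have "\<forall>q\<ge>2. poly (cyclotomic_poly m) q \<le> poly (cyclotomic_poly n) q"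
      using steep_log_defect by (auto simp: cyclotomic_le assms ln_m ln_n)
    then show ?thesis by blast
  qed
qed

end
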